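(* Let $A\in\mathbb{R}^{N\times N}$ and $\widetilde A\in\mathbb{R}^{\widetilde N\times\widetilde N}$ be the symmetric positive definite matrix and its auxiliary domain decomposition matrix described in the context, related by $A=R\widetilde A R^T$ with $R\in\mathbb{R}^{N\times\widetilde N}$. Let $\widetilde D\in\mathbb{R}^{\widetilde N\times\widetilde N}$ be a block-diagonal matrix such that $R\widetilde D R^T$ is invertible, put $$\Pi_{\widetilde D}=(R\widetilde D R^T)^{-1}R\widetilde D,\qquad \pi_{\widetilde D}=R^T\Pi_{\widetilde D},$$ and let the two-grid preconditioner $C$ be defined through its inverse $$C^{-1}=\Pi_{\widetilde D}\,\widetilde A^{-1}\,\Pi_{\widetilde D}^T .$$ Then, with $c_\Pi=\|\pi_{\widetilde D}\|_{\widetilde A}^2$, $$\mathbf v^TC\mathbf v\le\mathbf v^TA\mathbf v\le c_\Pi\,\mathbf v^TC\mathbf v\qquad\text{for all }\mathbf v\in\mathbb{R}^N,$$ and the condition number of the preconditioned matrix satisfies $$\kappa(C^{-1}A)\le c_\Pi=\|\pi_{\widetilde D}\|_{\widetilde A}^2 .$$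
   Context: Construction of $\widetilde A$ and $R$. A set of $N$ degrees of freedom is partitioned into $N_1$ fine and $N_2$ coarse ones ($N=N_1+N_2$, fine ones numbered first), and is covered by $n$ (possibly overlapping) subsets associated with subdomains $i=1,\dots,n$. $R_i$ is the Boolean matrix restricting a global vector to the degrees of freedom of subdomain $i$; in the fine/coarse splitting $R_i$ is block diagonal with blocks $R_{i:1}$ (restriction of fine degrees of freedom) and $R_{i:2}$ (restriction of coarse ones). The symmetric positive definite matrix $A$ is assembled from symmetric positive semidefinite local matrices $$A=\sum_{i=1}^n R_i^T A_i R_i,\qquad A_i=\begin{bmatrix} A_{i:11} & A_{i:12} \\ A_{i:21} & A_{i:22} \end{bmatrix}.$$ The auxiliary matrix is $$\widetilde A=\begin{bmatrix} \widetilde A_{11} & \widetilde A_{12} \\ \widetilde A_{21} & \widetilde A_{22} \end{bmatrix},\quad \widetilde A_{11}=\operatorname{diag}\{A_{1:11},\dots,A_{n:11}\},\quad \widetilde A_{12}=\begin{bmatrix} A_{1:12}R_{1:2} \\ \vdots \\ A_{n:12}R_{n:2} \end{bmatrix}=\widetilde A_{21}^T,\quad \widetilde A_{22}=\sum_{i=1}^n R_{i:2}^T A_{i:22} R_{i:2},$$ and it is assumed to be invertible (hence symmetric positive definite). The matrix $R$ is $$R=\begin{bmatrix} R_1 & 0 \\ 0 & I_2 \end{bmatrix},\qquad R_1^T=\begin{bmatrix} R_{1:1} \\ \vdots \\ R_{n:1} \end{bmatrix},$$ with $I_2$ the $N_2\times N_2$ identity, so that $A=R\widetilde A R^T$. "Block-diagonal"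 for $\widetilde D$ refers to the fine/coarse block structure of $\widetilde A$; e.g. $\widetilde D=\begin{bmatrix} \widetilde D_{11} & 0 \\ 0 & I \end{bmatrix}$ with $\widetilde D_{11}=\widetilde A_{11}$ or $\widetilde D_{11}=\operatorname{diag}(\widetilde A_{11})$. $\|\cdot\|_{\widetilde A}$ is the matrix norm induced by the vector norm $\|\tilde{\mathbf v}\|_{\widetilde A}=(\tilde{\mathbf v}^T\widetilde A\tilde{\mathbf v})^{1/2}$ on $\mathbb{R}^{\widetilde N}$. $\kappa(C^{-1}A)$ is the spectral condition number, i.e. the ratio of the largest to the smallest eigenvalue of $C^{-1}A$ (which are real and positive). *)

theory Defs
  imports
    "Jordan_Normal_Form.Gauss_Jordan_Elimination"
    "Jordan_Normal_Form.Spectral_Radius"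
begin

definition spsd_mat :: "nat \<Rightarrow> real mat \<Rightarrow> bool" where
  "spsd_mat n A \<longleftrightarrow> A \<in> carrier_mat n n \<and> transpose_mat A = A \<and>
     (\<forall>v \<in> carrier_vec n. 0 \<le> v \<bullet> (A *\<^sub>v v))"

definition spd_mat :: "nat \<Rightarrow> real mat \<Rightarrow> bool" where
  "spd_mat n A \<longleftrightarrow> A \<in> carrier_mat n n \<and> transpose_mat A = A \<and>
     (\<forall>v \<in> carrier_vec n. v \<noteq> 0\<^sub>v n \<longrightarrow> 0 < v \<bullet> (A *\<^sub>v v))"

text \<open>Unspecified unless the argument is invertible.\<close>

definition mat_inv :: "real mat \<Rightarrow> real mat" where
  "mat_inv A = the (mat_inverse A)"

text \<open>The list \<open>is\<close> enumerates, without repetition, a subset of the indices below \<open>m\<close>; its order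
  is the local numbering of that subset.\<close>

definition restriction_mat :: "nat \<Rightarrow> nat list \<Rightarrow> real mat" where
  "restriction_mat m is = mat (length is) m (\<lambda>(k, j). if is ! k = j then 1 else 0)"

definition mat_sum :: "nat \<Rightarrow> nat \<Rightarrow> (nat \<Rightarrow> real mat) \<Rightarrow> nat set \<Rightarrow> real mat" where
  "mat_sum nr nc M I = mat nr nc (\<lambda>rc. \<Sum>i\<in>I. M i $$ rc)"

definition stack_rows :: "nat \<Rightarrow> real mat list \<Rightarrow> real mat" where
  "stack_rows nc Ms = foldr append_rows Ms (0\<^sub>m 0 nc)"

definition block_diag2 :: "real mat \<Rightarrow> real mat \<Rightarrow> real mat" where
  "block_diag2 A B =
     four_block_mat A (0\<^sub>m (dim_row A) (dim_col B)) (0\<^sub>m (dim_row B) (dim_col A)) B"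

definition energy_norm :: "real mat \<Rightarrow> real vec \<Rightarrow> real" where
  "energy_norm B v = sqrt (v \<bullet> (B *\<^sub>v v))"

definition induced_norm :: "real mat \<Rightarrow> real mat \<Rightarrow> real" where
  "induced_norm B M =
     (SUP v \<in> carrier_vec (dim_row B) - {0\<^sub>v (dim_row B)}.
        energy_norm B (M *\<^sub>v v) / energy_norm B v)"

text \<open>For real matrices all of whose eigenvalues are real and positive; \<open>spectrum\<close> is then the set
  of all eigenvalues.\<close>

definition spectral_cond :: "real mat \<Rightarrow> real" where
  "spectral_cond M = Max (spectrum M) / Min (spectrum M)"

end

theory Submission
  imports Defs
begin

text \<open>For a coarse vector \<open>z\<close> and local fine vectors \<open>x\<^sub>i\<close>, the energy of their concatenation in the auxiliary
  matrix is the sum of the local energies of \<open>(x\<^sub>i, R\<^sub>i\<^sub>:\<^sub>2 z)\<close>. Hence the auxiliary matrix \<open>B\<close> is semidefinite, so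
  definite once invertible, and taking \<open>x\<^sub>i = R\<^sub>i\<^sub>:\<^sub>1 v\<^sub>1\<close> gives \<open>v\<^sup>T A v = \<parallel>R\<^sup>T v\<parallel>\<^sub>B\<^sup>2\<close>.

  Put \<open>w = B\<inverse> \<Pi>\<^sup>T C v\<close>. Then \<open>\<Pi> w = v\<close> and \<open>\<parallel>w\<parallel>\<^sub>B\<^sup>2 = v\<^sup>T C v\<close>, and \<open>\<Pi> R\<^sup>T = I\<close> shows that \<open>v\<^sup>T C v\<close> is also the
  \<open>B\<close>-inner product of \<open>w\<close> and \<open>R\<^sup>T v\<close>. The lower bound is Cauchy-Schwarz for this pair; the upper bound
  holds because \<open>R\<^sup>T v\<close> is the image of \<open>w\<close> under \<open>\<pi> = R\<^sup>T \<Pi>\<close>. Both bounds applied to an eigenvector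
  confine the spectrum of \<open>C\<inverse> A\<close> to \<open>[1, c]\<close>.\<close>

section \<open>Invertibility and inverses\<close>

lemma det_nonzero_of_invertible:
  fixes A :: "real mat"
  assumes "A \<in> carrier_mat n n" "invertible_mat A"
  shows "det A \<noteq> 0"
proof -
  obtain B where AB: "A * B = 1\<^sub>m n" and BA: "B * A = 1\<^sub>m (dim_row B)"
    using assms unfolding invertible_mat_def inverts_mat_def by auto
  \<comment> \<open>\<open>inverts_mat\<close> takes the size of its identity from the left factor,
    so the shape of \<open>B\<close> has to be recovered from both products.\<close>
  have "dim_col B = n" using arg_cong[OF AB, of dim_col] by simp
  moreover have "dim_row B = n" using arg_cong[OF BA, of dim_col] assms by simp
  ultimately have "B \<in> carrier_mat n n" by auto
  then have "det A * det B = 1" using det_mult[OF assms(1), of B] AB by (metis det_one)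
  then show ?thesis by auto
qed

text \<open>A nonzero determinant makes \<open>A\<close> a unit of the matrix ring, so Gauss-Jordan
  elimination returns \<open>Some\<close> matrix. Only then does the \<open>the\<close> inside
  \<open>mat_inv\<close> have a specified value.\<close>

lemma mat_inv:
  assumes A: "A \<in> carrier_mat n n" and "det A \<noteq> 0"
  shows mat_inv_carrier: "mat_inv A \<in> carrier_mat n n"
    and mult_mat_inv: "A * mat_inv A = 1\<^sub>m n"
    and mat_inv_mult: "mat_inv A * A = 1\<^sub>m n"
proof -
  have "A \<in> Units (ring_mat TYPE(real) n ())"
    using det_non_zero_imp_unit[OF assms] .
  then obtain B where "mat_inverse A = Some B"
    using mat_inverse(1)[OF A, of "()"] by (cases "mat_inverse A") auto
  then show "mat_inv A \<in> carrier_mat n n" "A * mat_inv A = 1\<^sub>m n" "mat_inv A * A = 1\<^sub>m n"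
    using mat_inverse(2)[OF A] by (auto simp: mat_inv_def)
qed

lemma mat_inv_vec:
  assumes A: "A \<in> carrier_mat n n" and d: "det A \<noteq> 0" and v: "v \<in> carrier_vec n"
  shows mult_mat_inv_vec: "A *\<^sub>v (mat_inv A *\<^sub>v v) = v"
    and mat_inv_mult_vec: "mat_inv A *\<^sub>v (A *\<^sub>v v) = v"
  using assoc_mult_mat_vec[OF A mat_inv_carrier[OF A d] v]
    assoc_mult_mat_vec[OF mat_inv_carrier[OF A d] A v]
    mult_mat_inv[OF A d] mat_inv_mult[OF A d] v by auto

section \<open>Symmetric forms, Cauchy-Schwarz and definiteness\<close>

lemma scalar_prod_mult_sym:
  fixes A :: "real mat"
  assumes "A \<in> carrier_mat n n" "transpose_mat A = A" "u \<in> carrier_vec n" "v \<in> carrier_vec n"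
  shows "u \<bullet> (A *\<^sub>v v) = v \<bullet> (A *\<^sub>v u)"
  using transpose_vec_mult_scalar[OF assms(1,4,3)] assms
    comm_scalar_prod[of "A *\<^sub>v u" n v] by simp

lemma quadratic_form_lincomb:
  fixes A :: "real mat"
  assumes A: "A \<in> carrier_mat n n" "transpose_mat A = A"
    and u: "u \<in> carrier_vec n" and v: "v \<in> carrier_vec n"
  shows "(s \<cdot>\<^sub>v u + t \<cdot>\<^sub>v v) \<bullet> (A *\<^sub>v (s \<cdot>\<^sub>v u + t \<cdot>\<^sub>v v)) =
    s\<^sup>2 * (u \<bullet> (A *\<^sub>v u)) + 2 * s * t * (u \<bullet> (A *\<^sub>v v)) + t\<^sup>2 * (v \<bullet> (A *\<^sub>v v))"
proof -
  have Au: "A *\<^sub>v u \<in> carrier_vec n" and Av: "A *\<^sub>v v \<in> carrier_vec n" using A u v by auto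
  have "A *\<^sub>v (s \<cdot>\<^sub>v u + t \<cdot>\<^sub>v v) = s \<cdot>\<^sub>v (A *\<^sub>v u) + t \<cdot>\<^sub>v (A *\<^sub>v v)"
    using A u v by (simp add: mult_add_distrib_mat_vec mult_mat_vec)
  then show ?thesis
    using Au Av u v scalar_prod_mult_sym[OF A u v]
    by (simp add: add_scalar_prod_distrib[of _ n] scalar_prod_add_distrib[of _ n]
        algebra_simps power2_eq_square)
qed

text \<open>Expand the nonnegative energy of \<open>s u + t v\<close>. The choices
  \<open>(c, -b)\<close> and \<open>(-b, a)\<close> for \<open>(s, t)\<close> give a multiple of
  \<open>a c - b^2\<close> by \<open>c\<close> and by \<open>a\<close>, which suffices if one of
  these is positive. If both vanish, the choice \<open>(1, -b)\<close> leaves \<open>-2 b^2\<close>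
  and forces \<open>b = 0\<close>.\<close>

lemma spsd_Cauchy_Schwarz:
  assumes A: "spsd_mat n A" and u: "u \<in> carrier_vec n" and v: "v \<in> carrier_vec n"
  shows "(u \<bullet> (A *\<^sub>v v))\<^sup>2 \<le> (u \<bullet> (A *\<^sub>v u)) * (v \<bullet> (A *\<^sub>v v))"
proof -
  have Ac: "A \<in> carrier_mat n n" "transpose_mat A = A"
    and pos: "\<And>v. v \<in> carrier_vec n \<Longrightarrow> 0 \<le> v \<bullet> (A *\<^sub>v v)"
    using A unfolding spsd_mat_def by auto
  define a b c where "a = u \<bullet> (A *\<^sub>v u)" and "b = u \<bullet> (A *\<^sub>v v)" and "c = v \<bullet> (A *\<^sub>v v)"
  have q: "0 \<le> s\<^sup>2 * a + 2 * s * t * b + t\<^sup>2 * c" for s t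
    using pos[of "s \<cdot>\<^sub>v u + t \<cdot>\<^sub>v v"] u v
    unfolding quadratic_form_lincomb[OF Ac u v] a_def b_def c_def by simp
  have 1: "0 \<le> c * (a * c - b\<^sup>2)"
    using q[of c "-b"] by (simp add: algebra_simps power2_eq_square)
  have 2: "0 \<le> a * (a * c - b\<^sup>2)"
    using q[of "-b" a] by (simp add: algebra_simps power2_eq_square)
  have 3: "0 \<le> a + c * b\<^sup>2 - 2 * b\<^sup>2"
    using q[of 1 "-b"] by (simp add: algebra_simps power2_eq_square)
  have "0 \<le> a" "0 \<le> c" using pos u v by (auto simp: a_def c_def)
  then consider "0 < a" | "0 < c" | "a = 0" "c = 0" by linarith
  then have "b\<^sup>2 \<le> a * c"
  proof cases
    case 1 then show ?thesis using 2 by (simp add: zero_le_mult_iff)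
  next
    case 2 then show ?thesis using 1 by (simp add: zero_le_mult_iff)
  next
    case 3 then show ?thesis using \<open>0 \<le> a + c * b\<^sup>2 - 2 * b\<^sup>2\<close> by simp
  qed
  then show ?thesis by (simp add: a_def b_def c_def)
qed

lemma spd_imp_spsd:
  assumes "spd_mat n A" shows "spsd_mat n A"
proof -
  have "0 \<le> v \<bullet> (A *\<^sub>v v)" if "v \<in> carrier_vec n" for v
  proof (cases "v = 0\<^sub>v n")
    case True
    then have "A *\<^sub>v v \<in> carrier_vec n" using assms unfolding spd_mat_def by auto
    then show ?thesis using True by simp
  next
    case False
    then show ?thesis using assms that unfolding spd_mat_def by (simp add: less_imp_le)
  qed
  then show ?thesis using assms unfolding spd_mat_def spsd_mat_def by auto
qed

lemma scalar_prod_self_real: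
  fixes v :: "real vec"
  shows "v \<in> carrier_vec n \<Longrightarrow> 0 \<le> v \<bullet> v"
    and "v \<in> carrier_vec n \<Longrightarrow> v \<bullet> v = 0 \<longleftrightarrow> v = 0\<^sub>v n"
proof -
  assume v: "v \<in> carrier_vec n"
  show "0 \<le> v \<bullet> v" unfolding scalar_prod_def by (simp add: sum_nonneg)
  show "v \<bullet> v = 0 \<longleftrightarrow> v = 0\<^sub>v n"
  proof
    assume "v \<bullet> v = 0"
    then have "\<forall>i<n. v $ i = 0"
      using v unfolding scalar_prod_def by (subst (asm) sum_nonneg_eq_0_iff) auto
    then show "v = 0\<^sub>v n" using v by (intro eq_vecI) auto
  qed (use v in auto)
qed

lemma spd_det_nonzero:
  assumes "spd_mat n A" shows "det A \<noteq> 0"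
proof
  assume "det A = 0"
  then obtain v where "v \<in> carrier_vec n" "v \<noteq> 0\<^sub>v n" "A *\<^sub>v v = 0\<^sub>v n"
    using det_0_iff_vec_prod_zero[of A n] assms unfolding spd_mat_def by auto
  then show False using assms unfolding spd_mat_def
    by (metis less_irrefl scalar_prod_right_zero)
qed

text \<open>Cauchy-Schwarz for the pair \<open>A v\<close> and \<open>v\<close> bounds the square of
  \<open>(A v) \<bullet> (A v)\<close> by a multiple of the energy of \<open>v\<close>. A vector of
  zero energy therefore lies in the kernel, which is trivial.\<close>

lemma spsd_det_nonzero_imp_spd:
  assumes A: "spsd_mat n A" and d: "det A \<noteq> 0"
  shows "spd_mat n A"
proof -
  have Ac: "A \<in> carrier_mat n n" using A unfolding spsd_mat_def by auto
  have "0 < v \<bullet> (A *\<^sub>v v)" if v: "v \<in> carrier_vec n" "v \<noteq> 0\<^sub>v n" for v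
  proof (rule ccontr)
    assume "\<not> 0 < v \<bullet> (A *\<^sub>v v)"
    then have 0: "v \<bullet> (A *\<^sub>v v) = 0" using A v unfolding spsd_mat_def by force
    have Av: "A *\<^sub>v v \<in> carrier_vec n" using Ac v by auto
    have "((A *\<^sub>v v) \<bullet> (A *\<^sub>v v))\<^sup>2 \<le> 0"
      using spsd_Cauchy_Schwarz[OF A Av v(1)] 0 by simp
    then have "A *\<^sub>v v = 0\<^sub>v n" using scalar_prod_self_real(2)[OF Av] by simp
    then show False using v d det_0_iff_vec_prod_zero[OF Ac] by auto
  qed
  then show ?thesis using A unfolding spsd_mat_def spd_mat_def by auto
qed

section \<open>Boundedness, coercivity and the induced norm\<close>

lemma quadratic_form_bounded:
  fixes M :: "real mat"
  assumes M: "M \<in> carrier_mat n n"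
  shows "\<exists>K\<ge>0. \<forall>v \<in> carrier_vec n. v \<bullet> (M *\<^sub>v v) \<le> K * (v \<bullet> v)"
proof (intro exI[of _ "\<Sum>i<n. \<Sum>j<n. \<bar>M $$ (i,j)\<bar>"] conjI ballI)
  fix v :: "real vec" assume v: "v \<in> carrier_vec n"
  have vv: "v \<bullet> v = (\<Sum>i<n. (v $ i)\<^sup>2)"
    using v unfolding scalar_prod_def by (simp add: atLeast0LessThan power2_eq_square)
  have comp: "(v $ i)\<^sup>2 \<le> v \<bullet> v" if "i < n" for i
    unfolding vv using that by (intro member_le_sum) auto
  \<comment> \<open>Every product of two entries is dominated by \<open>v \<bullet> v\<close>, so
    the sum of the absolute values of all matrix entries is an admissible constant. It is crude, but
    only the existence of some bound matters later.\<close>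
  have prod: "\<bar>v $ i * v $ j\<bar> \<le> v \<bullet> v" if "i < n" "j < n" for i j
  proof -
    have "2 * \<bar>v $ i * v $ j\<bar> \<le> (v $ i)\<^sup>2 + (v $ j)\<^sup>2"
      using sum_squares_bound[of "\<bar>v $ i\<bar>" "\<bar>v $ j\<bar>"] by (simp add: abs_mult)
    then show ?thesis using comp[OF that(1)] comp[OF that(2)] by linarith
  qed
  have "v \<bullet> (M *\<^sub>v v) = (\<Sum>i<n. \<Sum>j<n. M $$ (i,j) * (v $ i * v $ j))"
    using v M by (simp add: scalar_prod_def atLeast0LessThan sum_distrib_left ac_simps)
  also have "\<dots> \<le> (\<Sum>i<n. \<Sum>j<n. \<bar>M $$ (i,j)\<bar> * (v \<bullet> v))"
  proof (intro sum_mono)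
    fix i j assume "i \<in> {..<n}" "j \<in> {..<n}"
    then have "\<bar>M $$ (i,j)\<bar> * \<bar>v $ i * v $ j\<bar> \<le> \<bar>M $$ (i,j)\<bar> * (v \<bullet> v)"
      using prod by (intro mult_left_mono) auto
    then show "M $$ (i,j) * (v $ i * v $ j) \<le> \<bar>M $$ (i,j)\<bar> * (v \<bullet> v)"
      by (metis abs_ge_self abs_mult order_trans)
  qed
  finally show "v \<bullet> (M *\<^sub>v v) \<le> (\<Sum>i<n. \<Sum>j<n. \<bar>M $$ (i,j)\<bar>) * (v \<bullet> v)"
    by (simp add: sum_distrib_right)
qed (simp add: sum_nonneg)

text \<open>The bound comes from the inverse matrix. With \<open>v = B y\<close>, Cauchy-Schwarz for
  \<open>B\<close> gives \<open>(v \<bullet> v)^2 \<le> (v \<bullet> y) * (v \<bullet> (B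
  v))\<close>. The first factor is the form of the inverse of \<open>B\<close>, hence at most
  \<open>K * (v \<bullet> v)\<close>, and one factor \<open>v \<bullet> v\<close> cancels.\<close>

lemma spd_coercive:
  assumes B: "spd_mat n B"
  shows "\<exists>K\<ge>0. \<forall>v \<in> carrier_vec n. v \<bullet> v \<le> K * (v \<bullet> (B *\<^sub>v v))"
proof -
  have Bc: "B \<in> carrier_mat n n" "transpose_mat B = B" and d: "det B \<noteq> 0"
    using B spd_det_nonzero unfolding spd_mat_def by auto
  obtain K where K: "K \<ge> 0"
    "\<And>v. v \<in> carrier_vec n \<Longrightarrow> v \<bullet> (mat_inv B *\<^sub>v v) \<le> K * (v \<bullet> v)"
    using quadratic_form_bounded[OF mat_inv_carrier[OF Bc(1) d]] by auto
  have "v \<bullet> v \<le> K * (v \<bullet> (B *\<^sub>v v))" if v: "v \<in> carrier_vec n" for v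
  proof -
    define y where "y = mat_inv B *\<^sub>v v"
    have y: "y \<in> carrier_vec n" and By: "B *\<^sub>v y = v"
      using mat_inv_carrier[OF Bc(1) d] mult_mat_inv_vec[OF Bc(1) d v] v by (auto simp: y_def)
    have nn: "0 \<le> v \<bullet> (B *\<^sub>v v)"
      using spd_imp_spsd[OF B] v unfolding spsd_mat_def by auto
    have "(v \<bullet> v)\<^sup>2 = (y \<bullet> (B *\<^sub>v v))\<^sup>2"
      using scalar_prod_mult_sym[OF Bc y v] By by simp
    also have "\<dots> \<le> (y \<bullet> v) * (v \<bullet> (B *\<^sub>v v))"
      using spsd_Cauchy_Schwarz[OF spd_imp_spsd[OF B] y v] By by simp
    also have "y \<bullet> v = v \<bullet> y" using y v by (rule comm_scalar_prod)
    also have "(v \<bullet> y) * (v \<bullet> (B *\<^sub>v v)) \<le> K * (v \<bullet> v) * (v \<bullet> (B *\<^sub>v v))"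
      using K(2)[OF v] nn by (intro mult_right_mono) (auto simp: y_def)
    finally have *: "(v \<bullet> v) * (v \<bullet> v) \<le> (v \<bullet> v) * (K * (v \<bullet> (B *\<^sub>v v)))"
      by (simp add: power2_eq_square ac_simps)
    show ?thesis
    proof (cases "v \<bullet> v = 0")
      case True then show ?thesis using K nn by simp
    next
      case False
      then have "0 < v \<bullet> v" using scalar_prod_self_real(1)[OF v] by simp
      then show ?thesis using * by simp
    qed
  qed
  then show ?thesis using K by auto
qed

text \<open>A real supremum is an upper bound only for a set bounded above, so the work lies in
  bounding the quotients in \<open>induced_norm\<close>. The zero vector is excluded from that
  supremum and is treated separately.\<close>

lemma energy_le_induced_norm:
  assumes B: "spd_mat n B" and M: "M \<in> carrier_mat n n" and v: "v \<in> carrier_vec n"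
  shows "(M *\<^sub>v v) \<bullet> (B *\<^sub>v (M *\<^sub>v v)) \<le> (induced_norm B M)\<^sup>2 * (v \<bullet> (B *\<^sub>v v))"
proof (cases "v = 0\<^sub>v n")
  case True
  have Bc: "B \<in> carrier_mat n n" using B unfolding spd_mat_def by auto
  have "M *\<^sub>v v = 0\<^sub>v n" using True M by auto
  moreover have "B *\<^sub>v 0\<^sub>v n = 0\<^sub>v n" using Bc by auto
  ultimately show ?thesis using True by simp
next
  case False
  have Bc: "B \<in> carrier_mat n n" and pd: "\<And>v. v \<in> carrier_vec n \<Longrightarrow> v \<noteq> 0\<^sub>v n \<Longrightarrow> 0 < v \<bullet> (B *\<^sub>v v)"
    using B unfolding spd_mat_def by auto
  have psd: "0 \<le> w \<bullet> (B *\<^sub>v w)" if "w \<in> carrier_vec n" for w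
    using spd_imp_spsd[OF B] that unfolding spsd_mat_def by auto
  let ?f = "\<lambda>v. energy_norm B (M *\<^sub>v v) / energy_norm B v"
  \<comment> \<open>The energy of \<open>M v\<close> is the quadratic form of \<open>M^T B M\<close>
    at \<open>v\<close>. \<open>K\<close> bounds it by \<open>v \<bullet> v\<close>, and
    \<open>L\<close> returns from there to the energy of \<open>v\<close>, so the quotients stay
    below \<open>sqrt (K * L)\<close>.\<close>
  obtain K where K: "K \<ge> 0"
    "\<And>v. v \<in> carrier_vec n \<Longrightarrow> v \<bullet> ((transpose_mat M * (B * M)) *\<^sub>v v) \<le> K * (v \<bullet> v)"
    using quadratic_form_bounded[of "transpose_mat M * (B * M)" n] M Bc by auto
  obtain L where L: "L \<ge> 0" "\<And>v. v \<in> carrier_vec n \<Longrightarrow> v \<bullet> v \<le> L * (v \<bullet> (B *\<^sub>v v))"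
    using spd_coercive[OF B] by auto
  have bdd: "?f w \<le> sqrt (K * L)" if w: "w \<in> carrier_vec n" "w \<noteq> 0\<^sub>v n" for w
  proof -
    have Mw: "M *\<^sub>v w \<in> carrier_vec n" using M w by auto
    have "(M *\<^sub>v w) \<bullet> (B *\<^sub>v (M *\<^sub>v w)) = (B *\<^sub>v (M *\<^sub>v w)) \<bullet> (M *\<^sub>v w)"
      using Mw Bc by (intro comm_scalar_prod[of _ n]) auto
    also have "\<dots> = (transpose_mat M *\<^sub>v (B *\<^sub>v (M *\<^sub>v w))) \<bullet> w"
      using M Bc Mw w by (intro transpose_vec_mult_scalar[symmetric]) auto
    also have "\<dots> = w \<bullet> (transpose_mat M *\<^sub>v (B *\<^sub>v (M *\<^sub>v w)))"
      using M Bc Mw w by (intro comm_scalar_prod[of _ n]) auto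
    also have "transpose_mat M *\<^sub>v (B *\<^sub>v (M *\<^sub>v w)) = (transpose_mat M * (B * M)) *\<^sub>v w"
      using M Bc w by (simp add: assoc_mult_mat_vec[of _ n n _ n])
    also have "w \<bullet> \<dots> \<le> K * (w \<bullet> w)" using K w by auto
    also have "\<dots> \<le> K * L * (w \<bullet> (B *\<^sub>v w))"
      using mult_left_mono[OF L(2)[OF w(1)] K(1)] by simp
    finally have "energy_norm B (M *\<^sub>v w) \<le> sqrt (K * L) * energy_norm B w"
      unfolding energy_norm_def by (simp flip: real_sqrt_mult)
    then show ?thesis using pd[OF w] by (simp add: energy_norm_def divide_le_eq)
  qed
  have "?f v \<le> induced_norm B M"
    unfolding induced_norm_def using v False bdd Bc
    by (intro cSUP_upper bdd_aboveI2[of _ _ "sqrt (K * L)"]) auto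
  then have "energy_norm B (M *\<^sub>v v) \<le> induced_norm B M * energy_norm B v"
    using pd[OF v False] by (simp add: energy_norm_def divide_le_eq)
  then have "(energy_norm B (M *\<^sub>v v))\<^sup>2 \<le> (induced_norm B M * energy_norm B v)\<^sup>2"
    using psd M v by (intro power_mono) (auto simp: energy_norm_def)
  then show ?thesis using psd M v by (simp add: energy_norm_def power_mult_distrib)
qed

section \<open>Real eigenvalues of self-adjoint matrices\<close>

text \<open>The maximum and minimum defining \<open>spectral_cond\<close> are unspecified on an empty spectrum. A complex
  eigenvalue exists, and self-adjointness with respect to \<open>G\<close> makes it real.\<close>

lemma spectrum_self_adjoint_nonempty:
  fixes M G :: "real mat"
  assumes G: "spd_mat n G" and M: "M \<in> carrier_mat n n" and n: "0 < n"
    and adj: "\<And>x y. x \<in> carrier_vec n \<Longrightarrow> y \<in> carrier_vec n \<Longrightarrow>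
      x \<bullet> (G *\<^sub>v (M *\<^sub>v y)) = y \<bullet> (G *\<^sub>v (M *\<^sub>v x))"
  shows "spectrum M \<noteq> {}"
proof -
  let ?Mc = "map_mat complex_of_real M"
  have Gc: "G \<in> carrier_mat n n" "transpose_mat G = G" using G unfolding spd_mat_def by auto
  obtain k where "k \<in> spectrum ?Mc" using spectrum_non_empty[of ?Mc n] M n by auto
  then obtain z where z: "z \<in> carrier_vec n" "z \<noteq> 0\<^sub>v n" "?Mc *\<^sub>v z = k \<cdot>\<^sub>v z"
    using M unfolding spectrum_def eigenvalue_def eigenvector_def by auto
  define x y where "x = map_vec Re z" and "y = map_vec Im z"
  have x: "x \<in> carrier_vec n" and y: "y \<in> carrier_vec n" using z by (auto simp: x_def y_def)
  have comp: "(\<Sum>j<n. complex_of_real (M $$ (i,j)) * z $ j) = k * z $ i" if "i < n" for i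
    using arg_cong[OF z(3), of "\<lambda>v. v $ i"] that z(1) M
    by (simp add: scalar_prod_def atLeast0LessThan)
  \<comment> \<open>Real and imaginary parts of the eigenvalue equation: the span of
    \<open>x\<close> and \<open>y\<close> is invariant under \<open>M\<close>, which acts on it like
    multiplication by \<open>k\<close>.\<close>
  have Mx: "M *\<^sub>v x = Re k \<cdot>\<^sub>v x + (- Im k) \<cdot>\<^sub>v y"
  proof (rule eq_vecI)
    fix i assume "i < dim_vec (Re k \<cdot>\<^sub>v x + (- Im k) \<cdot>\<^sub>v y)"
    then have i: "i < n" using y by auto
    show "(M *\<^sub>v x) $ i = (Re k \<cdot>\<^sub>v x + (- Im k) \<cdot>\<^sub>v y) $ i"
      using arg_cong[OF comp[OF i], of Re] i z(1) M
      by (simp add: scalar_prod_def atLeast0LessThan x_def y_def)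
  qed (use M y in auto)
  have My: "M *\<^sub>v y = Im k \<cdot>\<^sub>v x + Re k \<cdot>\<^sub>v y"
  proof (rule eq_vecI)
    fix i assume "i < dim_vec (Im k \<cdot>\<^sub>v x + Re k \<cdot>\<^sub>v y)"
    then have i: "i < n" using y by auto
    show "(M *\<^sub>v y) $ i = (Im k \<cdot>\<^sub>v x + Re k \<cdot>\<^sub>v y) $ i"
      using arg_cong[OF comp[OF i], of Im] i z(1) M
      by (simp add: scalar_prod_def atLeast0LessThan x_def y_def)
  qed (use M y in auto)
  have lin: "w \<bullet> (G *\<^sub>v (s \<cdot>\<^sub>v x + t \<cdot>\<^sub>v y)) = s * (w \<bullet> (G *\<^sub>v x)) + t * (w \<bullet> (G *\<^sub>v y))"
    if "w \<in> carrier_vec n" for w s t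
  proof -
    have "G *\<^sub>v (s \<cdot>\<^sub>v x + t \<cdot>\<^sub>v y) = s \<cdot>\<^sub>v (G *\<^sub>v x) + t \<cdot>\<^sub>v (G *\<^sub>v y)"
      using Gc x y by (simp add: mult_add_distrib_mat_vec mult_mat_vec)
    moreover have "G *\<^sub>v x \<in> carrier_vec n" "G *\<^sub>v y \<in> carrier_vec n" using Gc x y by auto
    ultimately show ?thesis using that by (simp add: scalar_prod_add_distrib[of _ n])
  qed
  \<comment> \<open>Self-adjointness equates \<open>x \<bullet> (G M y)\<close> with
    \<open>y \<bullet> (G M x)\<close>. The \<open>Re k\<close> terms cancel by symmetry of
    \<open>G\<close>, and what remains is \<open>Im k\<close> times the sum of the energies of
    \<open>x\<close> and \<open>y\<close>, a positive number.\<close>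
  have "Im k * (x \<bullet> (G *\<^sub>v x) + y \<bullet> (G *\<^sub>v y)) = 0"
    using adj[OF x y] lin[OF x, of "Im k" "Re k"] lin[OF y, of "Re k" "- Im k"]
      scalar_prod_mult_sym[OF Gc x y]
    unfolding Mx My by (simp add: algebra_simps)
  moreover have xy: "x \<noteq> 0\<^sub>v n \<or> y \<noteq> 0\<^sub>v n"
  proof (rule ccontr)
    assume "\<not> (x \<noteq> 0\<^sub>v n \<or> y \<noteq> 0\<^sub>v n)"
    then have *: "x = 0\<^sub>v n" "y = 0\<^sub>v n" by auto
    have "z $ i = 0" if "i < n" for i
      using arg_cong[OF *(1), of "\<lambda>v. v $ i"] arg_cong[OF *(2), of "\<lambda>v. v $ i"] that z(1)
      by (simp add: x_def y_def complex_eq_iff)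
    then show False using z(1,2) by (auto intro!: eq_vecI)
  qed
  moreover have "0 \<le> x \<bullet> (G *\<^sub>v x)" "0 \<le> y \<bullet> (G *\<^sub>v y)"
    "x \<noteq> 0\<^sub>v n \<Longrightarrow> 0 < x \<bullet> (G *\<^sub>v x)" "y \<noteq> 0\<^sub>v n \<Longrightarrow> 0 < y \<bullet> (G *\<^sub>v y)"
    using G spd_imp_spsd[OF G] x y unfolding spd_mat_def spsd_mat_def by auto
  ultimately have k: "Im k = 0" by (metis add_nonneg_pos add_pos_nonneg less_irrefl mult_eq_0_iff)
  have "M *\<^sub>v x = Re k \<cdot>\<^sub>v x" "M *\<^sub>v y = Re k \<cdot>\<^sub>v y"
    using x y unfolding Mx My k by (auto intro!: eq_vecI)
  \<comment> \<open>Whichever of \<open>x\<close> and \<open>y\<close> is nonzero serves as a real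
    eigenvector.\<close>
  then have "eigenvalue M (Re k)"
    using xy x y M unfolding eigenvalue_def eigenvector_def by auto
  then show ?thesis unfolding spectrum_def by auto
qed

section \<open>Spectral equivalence in an abstract auxiliary space\<close>

lemma auxiliary_space_bounds:
  fixes A B R P :: "real mat"
  assumes B: "spd_mat m B" and A: "spd_mat N A" and N: "0 < N"
    and R: "R \<in> carrier_mat N m" and P: "P \<in> carrier_mat N m"
    and PR: "P * transpose_mat R = 1\<^sub>m N"
    and energy: "\<And>v. v \<in> carrier_vec N \<Longrightarrow>
      v \<bullet> (A *\<^sub>v v) = (transpose_mat R *\<^sub>v v) \<bullet> (B *\<^sub>v (transpose_mat R *\<^sub>v v))"
  defines "Cinv \<equiv> P * mat_inv B * transpose_mat P"
  defines "c \<equiv> (induced_norm B (transpose_mat R * P))\<^sup>2"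
  shows "\<forall>v \<in> carrier_vec N. v \<bullet> (mat_inv Cinv *\<^sub>v v) \<le> v \<bullet> (A *\<^sub>v v) \<and>
      v \<bullet> (A *\<^sub>v v) \<le> c * (v \<bullet> (mat_inv Cinv *\<^sub>v v))"
    and "spectral_cond (Cinv * A) \<le> c"
proof -
  have Bc: "B \<in> carrier_mat m m" "transpose_mat B = B" and dB: "det B \<noteq> 0"
    using B spd_det_nonzero unfolding spd_mat_def by auto
  have Ac: "A \<in> carrier_mat N N" "transpose_mat A = A"
    using A unfolding spd_mat_def by auto
  have Rt: "transpose_mat R \<in> carrier_mat m N" and Pt: "transpose_mat P \<in> carrier_mat m N"
    using R P by auto
  note Bi = mat_inv_carrier[OF Bc(1) dB]
  have Cc: "Cinv \<in> carrier_mat N N" using P Pt Bi unfolding Cinv_def by auto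
  \<comment> \<open>\<open>lift\<close> factors \<open>Cinv\<close> through the auxiliary space:
    \<open>P\<close> maps \<open>lift u\<close> to \<open>Cinv u\<close>, and by
    \<open>Clift\<close> the form of \<open>Cinv\<close> is the \<open>B\<close>-inner product of
    lifts.\<close>
  define lift where "lift u = mat_inv B *\<^sub>v (transpose_mat P *\<^sub>v u)" for u
  have lift: "lift u \<in> carrier_vec m" "B *\<^sub>v lift u = transpose_mat P *\<^sub>v u" "P *\<^sub>v lift u = Cinv *\<^sub>v u"
    if u: "u \<in> carrier_vec N" for u
  proof -
    have Pu: "transpose_mat P *\<^sub>v u \<in> carrier_vec m" using Pt u by auto
    show "lift u \<in> carrier_vec m" using Bi Pu unfolding lift_def by auto
    show "B *\<^sub>v lift u = transpose_mat P *\<^sub>v u"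
      unfolding lift_def by (rule mult_mat_inv_vec[OF Bc(1) dB Pu])
    have "Cinv *\<^sub>v u = (P * mat_inv B) *\<^sub>v (transpose_mat P *\<^sub>v u)"
      unfolding Cinv_def using P Bi Pt u by (intro assoc_mult_mat_vec) auto
    also have "\<dots> = P *\<^sub>v lift u"
      unfolding lift_def using P Bi Pu by (intro assoc_mult_mat_vec) auto
    finally show "P *\<^sub>v lift u = Cinv *\<^sub>v u" by simp
  qed
  have Clift: "u \<bullet> (Cinv *\<^sub>v v) = lift v \<bullet> (B *\<^sub>v lift u)"
    if u: "u \<in> carrier_vec N" and v: "v \<in> carrier_vec N" for u v
  proof -
    have "u \<bullet> (Cinv *\<^sub>v v) = (transpose_mat P *\<^sub>v u) \<bullet> lift v"
      using transpose_vec_mult_scalar[OF P lift(1)[OF v] u] lift(3)[OF v] by simp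
    also have "\<dots> = lift v \<bullet> (B *\<^sub>v lift u)"
      unfolding lift(2)[OF u] using Pt u lift(1)[OF v] by (intro comm_scalar_prod[of _ m]) auto
    finally show ?thesis .
  qed
  have pair: "(transpose_mat P *\<^sub>v u) \<bullet> (transpose_mat R *\<^sub>v v) = u \<bullet> v"
    if u: "u \<in> carrier_vec N" and v: "v \<in> carrier_vec N" for u v
  proof -
    have "P *\<^sub>v (transpose_mat R *\<^sub>v v) = v"
      using assoc_mult_mat_vec[OF P Rt v] PR v by simp
    then show ?thesis
      using transpose_vec_mult_scalar[OF P _ u, of "transpose_mat R *\<^sub>v v"] Rt v by simp
  qed
  \<comment> \<open>Without invertibility \<open>mat_inv Cinv\<close> would be unspecified. A kernel
    vector \<open>u\<close> has a lift of zero energy, so \<open>P^T u = 0\<close>, and pairing this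
    with \<open>R^T u\<close> yields \<open>u \<bullet> u = 0\<close>.\<close>
  have dC: "det Cinv \<noteq> 0"
  proof
    assume "det Cinv = 0"
    then obtain u where u: "u \<in> carrier_vec N" "u \<noteq> 0\<^sub>v N" "Cinv *\<^sub>v u = 0\<^sub>v N"
      using det_0_iff_vec_prod_zero[OF Cc] by auto
    have "lift u \<bullet> (B *\<^sub>v lift u) = 0" using Clift[OF u(1) u(1)] u by simp
    then have "lift u = 0\<^sub>v m" using B lift(1)[OF u(1)] unfolding spd_mat_def by fastforce
    moreover have "B *\<^sub>v 0\<^sub>v m = 0\<^sub>v m" using Bc(1) by auto
    ultimately have "transpose_mat P *\<^sub>v u = 0\<^sub>v m" using lift(2)[OF u(1)] by simp
    then have "u \<bullet> u = 0" using pair[OF u(1) u(1)] Rt u by auto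
    then show False using scalar_prod_self_real(2)[OF u(1)] u by simp
  qed
  let ?C = "mat_inv Cinv"
  note Ci = mat_inv_carrier[OF Cc dC]
  have lower: "v \<bullet> (?C *\<^sub>v v) \<le> v \<bullet> (A *\<^sub>v v)"
    and upper: "v \<bullet> (A *\<^sub>v v) \<le> c * (v \<bullet> (?C *\<^sub>v v))"
    and Cpos: "v \<noteq> 0\<^sub>v N \<Longrightarrow> 0 < v \<bullet> (?C *\<^sub>v v)"
    if v: "v \<in> carrier_vec N" for v
  proof -
    \<comment> \<open>Since \<open>u\<close> is the image of \<open>v\<close> under
      \<open>C\<close>, its lift \<open>w\<close> is a preimage of \<open>v\<close> under
      \<open>P\<close>. The vector \<open>y\<close> is another one, because
      \<open>P R^T = I\<close>.\<close>
    define u w y where "u = ?C *\<^sub>v v" and "w = lift u" and "y = transpose_mat R *\<^sub>v v"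
    have u: "u \<in> carrier_vec N" and y: "y \<in> carrier_vec m"
      using Ci Rt v by (auto simp: u_def y_def)
    have Cu: "Cinv *\<^sub>v u = v" unfolding u_def by (rule mult_mat_inv_vec[OF Cc dC v])
    have w: "w \<in> carrier_vec m" "P *\<^sub>v w = v" "B *\<^sub>v w = transpose_mat P *\<^sub>v u"
      using lift[OF u] Cu by (auto simp: w_def)
    have uv: "v \<bullet> u = u \<bullet> v" using u v by (intro comm_scalar_prod[of _ N])
    have ww: "w \<bullet> (B *\<^sub>v w) = v \<bullet> (?C *\<^sub>v v)"
      using Clift[OF u u] Cu uv by (simp add: w_def u_def)
    have yy: "y \<bullet> (B *\<^sub>v y) = v \<bullet> (A *\<^sub>v v)" using energy[OF v] by (simp add: y_def)
    have wy: "w \<bullet> (B *\<^sub>v y) = v \<bullet> (?C *\<^sub>v v)"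
    proof -
      have "w \<bullet> (B *\<^sub>v y) = y \<bullet> (B *\<^sub>v w)" using scalar_prod_mult_sym[OF Bc w(1) y] .
      also have "\<dots> = (transpose_mat P *\<^sub>v u) \<bullet> y"
        unfolding w(3) using y Pt u by (intro comm_scalar_prod[of _ m]) auto
      also have "\<dots> = v \<bullet> (?C *\<^sub>v v)" using pair[OF u v] uv by (simp add: y_def u_def)
      finally show ?thesis .
    qed
    let ?e = "v \<bullet> (?C *\<^sub>v v)"
    have nn: "0 \<le> ?e" using ww spd_imp_spsd[OF B] w(1) unfolding spsd_mat_def by force
    have Ann: "0 \<le> v \<bullet> (A *\<^sub>v v)" using spd_imp_spsd[OF A] v unfolding spsd_mat_def by auto
    \<comment> \<open>Both the energy of \<open>w\<close> and its inner product with
      \<open>y\<close> equal \<open>?e\<close>, so Cauchy-Schwarz has \<open>?e\<close> on both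
      sides and one factor cancels when it is nonzero.\<close>
    have "?e * ?e \<le> ?e * (v \<bullet> (A *\<^sub>v v))"
      using spsd_Cauchy_Schwarz[OF spd_imp_spsd[OF B] w(1) y] ww yy wy
      by (simp add: power2_eq_square)
    then show "?e \<le> v \<bullet> (A *\<^sub>v v)" using nn Ann by (cases "?e = 0") auto
    have "(transpose_mat R * P) *\<^sub>v w = y"
      using assoc_mult_mat_vec[OF Rt P w(1)] w(2) by (simp add: y_def)
    then show "v \<bullet> (A *\<^sub>v v) \<le> c * ?e"
      using energy_le_induced_norm[OF B _ w(1), of "transpose_mat R * P"] Rt P yy ww
      by (simp add: c_def)
    show "0 < ?e" if "v \<noteq> 0\<^sub>v N"
    proof -
      have "w \<noteq> 0\<^sub>v m" using w(2) P that by auto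
      then show ?thesis using B w(1) ww unfolding spd_mat_def by auto
    qed
  qed
  show "\<forall>v \<in> carrier_vec N. v \<bullet> (?C *\<^sub>v v) \<le> v \<bullet> (A *\<^sub>v v) \<and> v \<bullet> (A *\<^sub>v v) \<le> c * (v \<bullet> (?C *\<^sub>v v))"
    using lower upper by auto
  have CA: "Cinv * A \<in> carrier_mat N N" using Cc Ac by auto
  have CAv: "(Cinv * A) *\<^sub>v v = Cinv *\<^sub>v (A *\<^sub>v v)" if "v \<in> carrier_vec N" for v
    using assoc_mult_mat_vec[OF Cc Ac(1) that] .
  have Csym: "u \<bullet> (Cinv *\<^sub>v v) = v \<bullet> (Cinv *\<^sub>v u)"
    if "u \<in> carrier_vec N" "v \<in> carrier_vec N" for u v
    using Clift that scalar_prod_mult_sym[OF Bc] lift(1) by simp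
  have bounds: "1 \<le> k \<and> k \<le> c" if k: "k \<in> spectrum (Cinv * A)" for k
  proof -
    obtain v where v: "v \<in> carrier_vec N" "v \<noteq> 0\<^sub>v N" "(Cinv * A) *\<^sub>v v = k \<cdot>\<^sub>v v"
      using k CA Cc unfolding spectrum_def eigenvalue_def eigenvector_def by auto
    \<comment> \<open>Applying \<open>C\<close> to the eigenvalue equation turns it into
      \<open>A v = k C v\<close>, so \<open>k\<close> is the ratio of the two energies of
      \<open>v\<close>. The denominator is positive by \<open>Cpos\<close>.\<close>
    have "A *\<^sub>v v = ?C *\<^sub>v (Cinv *\<^sub>v (A *\<^sub>v v))"
      using mat_inv_mult_vec[OF Cc dC] Ac v by simp
    also have "\<dots> = k \<cdot>\<^sub>v (?C *\<^sub>v v)"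
      using v CAv[OF v(1)] mult_mat_vec[OF Ci v(1)] by simp
    finally have "v \<bullet> (A *\<^sub>v v) = k * (v \<bullet> (?C *\<^sub>v v))"
      using v Ci by auto
    then show ?thesis using lower[OF v(1)] upper[OF v(1)] Cpos[OF v(1,2)] by simp
  qed
  have "spectrum (Cinv * A) \<noteq> {}"
  proof (rule spectrum_self_adjoint_nonempty[OF A CA N])
    fix x y :: "real vec" assume x: "x \<in> carrier_vec N" and y: "y \<in> carrier_vec N"
    have Axy: "A *\<^sub>v x \<in> carrier_vec N" "A *\<^sub>v y \<in> carrier_vec N" using Ac x y by auto
    have flip: "p \<bullet> (A *\<^sub>v q) = (A *\<^sub>v p) \<bullet> q" if "p \<in> carrier_vec N" "q \<in> carrier_vec N" for p q
      using transpose_vec_mult_scalar[OF Ac(1) that(2,1)] Ac by simp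
    \<comment> \<open>\<open>Cinv * A\<close> is self-adjoint in the \<open>A\<close>-inner product:
      both sides are the symmetric form of \<open>Cinv\<close> evaluated at \<open>A x\<close> and
      \<open>A y\<close>.\<close>
    show "x \<bullet> (A *\<^sub>v ((Cinv * A) *\<^sub>v y)) = y \<bullet> (A *\<^sub>v ((Cinv * A) *\<^sub>v x))"
      using flip x y Axy Csym CAv Cc by simp
  qed
  moreover have "finite (spectrum (Cinv * A))" by (rule card_finite_spectrum(1)[OF CA])
  ultimately have "Max (spectrum (Cinv * A)) \<le> c" "1 \<le> Min (spectrum (Cinv * A))"
    using bounds by auto
  moreover have "0 \<le> c" unfolding c_def by simp
  ultimately show "spectral_cond (Cinv * A) \<le> c"
    unfolding spectral_cond_def by (simp add: divide_le_eq mult_left_le order_trans mult_le_cancel_left1)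
qed

section \<open>Stacked vectors and block matrices\<close>

primrec stack_vecs :: "real vec list \<Rightarrow> real vec" where
  "stack_vecs [] = 0\<^sub>v 0"
| "stack_vecs (x # xs) = x @\<^sub>v stack_vecs xs"

lemma stack_vecs_carrier:
  assumes "\<And>i. i \<in> set is \<Longrightarrow> x i \<in> carrier_vec (l i)"
  shows "stack_vecs (map x is) \<in> carrier_vec (\<Sum>i\<leftarrow>is. l i)"
  using assms by (induction "is") auto

text \<open>Cuts an arbitrary fine vector of the auxiliary space into local pieces. The pieces form
  a function of the index, so distinctness is what allows the value at the head to be set without
  disturbing the tail.\<close>

lemma stack_vecs_exists:
  assumes "distinct is" "v \<in> carrier_vec (\<Sum>i\<leftarrow>is. l i)"
  shows "\<exists>x. (\<forall>i\<in>set is. x i \<in> carrier_vec (l i)) \<and> v = stack_vecs (map x is)"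
  using assms
proof (induction "is" arbitrary: v)
  case (Cons a as)
  let ?v1 = "vec_first v (l a)" and ?v2 = "vec_last v (\<Sum>i\<leftarrow>as. l i)"
  obtain x where x: "\<forall>i\<in>set as. x i \<in> carrier_vec (l i)" "?v2 = stack_vecs (map x as)"
    using Cons.IH[of ?v2] Cons.prems by auto
  have "map (x(a := ?v1)) as = map x as" using Cons.prems by auto
  moreover have "v = ?v1 @\<^sub>v ?v2" using Cons.prems by simp
  ultimately have "v = stack_vecs (map (x(a := ?v1)) (a # as))"
    using x(2) by (metis fun_upd_same list.simps(9) stack_vecs.simps(2))
  moreover have "\<forall>i\<in>set (a # as). (x(a := ?v1)) i \<in> carrier_vec (l i)" using x(1) by simp
  ultimately show ?case by blast
qed auto

lemma scalar_prod_stack_vecs: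
  assumes "\<And>i. i \<in> set is \<Longrightarrow> x i \<in> carrier_vec (l i)" "\<And>i. i \<in> set is \<Longrightarrow> y i \<in> carrier_vec (l i)"
  shows "stack_vecs (map x is) \<bullet> stack_vecs (map y is) = (\<Sum>i\<leftarrow>is. x i \<bullet> y i)"
  using assms
proof (induction "is")
  case (Cons a as)
  then show ?case
    using scalar_prod_append[of "x a" "l a" "stack_vecs (map x as)" "\<Sum>i\<leftarrow>as. l i" "y a" "stack_vecs (map y as)"]
    by (simp add: stack_vecs_carrier)
qed (simp add: scalar_prod_def)

lemma stack_rows_carrier:
  assumes "\<And>i. i \<in> set is \<Longrightarrow> M i \<in> carrier_mat (l i) nc"
  shows "stack_rows nc (map M is) \<in> carrier_mat (\<Sum>i\<leftarrow>is. l i) nc"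
  using assms by (induction "is") (auto simp: stack_rows_def)

lemma stack_rows_mult_vec:
  assumes "\<And>i. i \<in> set is \<Longrightarrow> M i \<in> carrier_mat (l i) nc" and v: "v \<in> carrier_vec nc"
  shows "stack_rows nc (map M is) *\<^sub>v v = stack_vecs (map (\<lambda>i. M i *\<^sub>v v) is)"
  using assms(1)
proof (induction "is")
  case Nil
  show ?case by (auto simp: stack_rows_def)
next
  case (Cons a as)
  have "stack_rows nc (map M (a # as)) = M a @\<^sub>r stack_rows nc (map M as)"
    by (simp add: stack_rows_def)
  then show ?case
    using mat_mult_append[of "M a" "l a" nc _ _ v] stack_rows_carrier[of as M l nc] Cons v by auto
qed

lemma diag_block_mat_carrier:
  assumes "\<And>i. i \<in> set is \<Longrightarrow> M i \<in> carrier_mat (l i) (l i)"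
  shows "diag_block_mat (map M is) \<in> carrier_mat (\<Sum>i\<leftarrow>is. l i) (\<Sum>i\<leftarrow>is. l i)"
  using assms by (induction "is") (auto simp: Let_def)

text \<open>\<open>stack_vecs\<close> and \<open>diag_block_mat\<close> recurse over the list in the
  same way, so each induction step is a two-by-two block product with zero off-diagonal
  blocks.\<close>

lemma diag_block_mat_mult_stack_vecs:
  assumes "\<And>i. i \<in> set is \<Longrightarrow> M i \<in> carrier_mat (l i) (l i)"
    and "\<And>i. i \<in> set is \<Longrightarrow> x i \<in> carrier_vec (l i)"
  shows "diag_block_mat (map M is) *\<^sub>v stack_vecs (map x is) = stack_vecs (map (\<lambda>i. M i *\<^sub>v x i) is)"
  using assms
proof (induction "is")
  case Nil
  show ?case by auto
next
  case (Cons a as)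
  let ?D = "diag_block_mat (map M as)" and ?s = "\<Sum>i\<leftarrow>as. l i"
  have D: "?D \<in> carrier_mat ?s ?s" and Ma: "M a \<in> carrier_mat (l a) (l a)"
    using Cons.prems by (auto intro: diag_block_mat_carrier)
  have "diag_block_mat (map M (a # as)) = four_block_mat (M a) (0\<^sub>m (l a) ?s) (0\<^sub>m ?s (l a)) ?D"
    using D Ma by (auto simp: Let_def)
  then show ?case
    using mult_mat_vec_split[OF Ma D, of "x a" "stack_vecs (map x as)"] Cons
    by (simp add: stack_vecs_carrier)
qed

lemma transpose_diag_block_mat:
  assumes "\<And>i. i \<in> set is \<Longrightarrow> M i \<in> carrier_mat (l i) (l i)"
    and "\<And>i. i \<in> set is \<Longrightarrow> transpose_mat (M i) = M i"
  shows "transpose_mat (diag_block_mat (map M is)) = diag_block_mat (map M is)"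
  using assms
proof (induction "is")
  case (Cons a as)
  let ?D = "diag_block_mat (map M as)" and ?s = "\<Sum>i\<leftarrow>as. l i"
  have D: "?D \<in> carrier_mat ?s ?s" and Ma: "M a \<in> carrier_mat (l a) (l a)"
    using Cons.prems by (auto intro: diag_block_mat_carrier)
  have "diag_block_mat (map M (a # as)) = four_block_mat (M a) (0\<^sub>m (l a) ?s) (0\<^sub>m ?s (l a)) ?D"
    using D Ma by (auto simp: Let_def)
  then show ?case
    using transpose_four_block_mat[OF Ma zero_carrier_mat zero_carrier_mat D] Cons by simp
qed auto

lemma block_diag2_mult_vec:
  assumes A: "A \<in> carrier_mat nr1 nc1" and B: "B \<in> carrier_mat nr2 nc2"
    and u: "u \<in> carrier_vec nc1" and v: "v \<in> carrier_vec nc2"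
  shows "block_diag2 A B *\<^sub>v (u @\<^sub>v v) = (A *\<^sub>v u) @\<^sub>v (B *\<^sub>v v)"
  using four_block_mat_mult_vec[OF A zero_carrier_mat zero_carrier_mat B u v] assms
  unfolding block_diag2_def by auto

lemma block_diag2_carrier:
  assumes "A \<in> carrier_mat nr1 nc1" and "B \<in> carrier_mat nr2 nc2"
  shows "block_diag2 A B \<in> carrier_mat (nr1 + nr2) (nc1 + nc2)"
  using assms unfolding block_diag2_def by auto

lemma transpose_block_diag2:
  assumes "A \<in> carrier_mat nr1 nc1" and "B \<in> carrier_mat nr2 nc2"
  shows "transpose_mat (block_diag2 A B) = block_diag2 (transpose_mat A) (transpose_mat B)"
  using transpose_four_block_mat[OF assms(1) zero_carrier_mat zero_carrier_mat assms(2)] assms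
  unfolding block_diag2_def by auto

section \<open>Quadratic forms and symmetry of assembled and block matrices\<close>

lemma mat_sum_quadratic_form:
  assumes M: "\<And>i. i \<in> I \<Longrightarrow> M i \<in> carrier_mat n n" and v: "v \<in> carrier_vec n"
  shows "v \<bullet> (mat_sum n n M I *\<^sub>v v) = (\<Sum>i\<in>I. v \<bullet> (M i *\<^sub>v v))"
proof -
  have form: "v \<bullet> (X *\<^sub>v v) = (\<Sum>r<n. \<Sum>s<n. v $ r * (X $$ (r,s) * v $ s))"
    if "X \<in> carrier_mat n n" for X
    using v that by (simp add: scalar_prod_def atLeast0LessThan sum_distrib_left)
  have "v \<bullet> (mat_sum n n M I *\<^sub>v v) = (\<Sum>r<n. \<Sum>s<n. \<Sum>i\<in>I. v $ r * (M i $$ (r,s) * v $ s))"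
    by (subst form) (auto simp: mat_sum_def sum_distrib_left sum_distrib_right intro!: sum.cong)
  also have "\<dots> = (\<Sum>r<n. \<Sum>i\<in>I. \<Sum>s<n. v $ r * (M i $$ (r,s) * v $ s))"
    by (intro sum.cong refl sum.swap)
  also have "\<dots> = (\<Sum>i\<in>I. \<Sum>r<n. \<Sum>s<n. v $ r * (M i $$ (r,s) * v $ s))"
    by (rule sum.swap)
  also have "\<dots> = (\<Sum>i\<in>I. v \<bullet> (M i *\<^sub>v v))"
    using M by (intro sum.cong refl) (simp add: form)
  finally show ?thesis .
qed

lemma congruence_quadratic_form:
  fixes X E :: "real mat"
  assumes E: "E \<in> carrier_mat k n" and X: "X \<in> carrier_mat k k" and v: "v \<in> carrier_vec n"
  shows "v \<bullet> ((transpose_mat E * X * E) *\<^sub>v v) = (E *\<^sub>v v) \<bullet> (X *\<^sub>v (E *\<^sub>v v))"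
proof -
  have Ev: "E *\<^sub>v v \<in> carrier_vec k" and Et: "transpose_mat E \<in> carrier_mat n k" using E v by auto
  have XEv: "X *\<^sub>v (E *\<^sub>v v) \<in> carrier_vec k" using X Ev by auto
  have "(transpose_mat E * X * E) *\<^sub>v v = transpose_mat E *\<^sub>v (X *\<^sub>v (E *\<^sub>v v))"
    using assoc_mult_mat_vec[of "transpose_mat E * X" n k E n v] assoc_mult_mat_vec[OF Et X Ev] E Et X v
    by simp
  then have "v \<bullet> ((transpose_mat E * X * E) *\<^sub>v v) = (transpose_mat E *\<^sub>v (X *\<^sub>v (E *\<^sub>v v))) \<bullet> v"
    using comm_scalar_prod[of v n "transpose_mat E *\<^sub>v (X *\<^sub>v (E *\<^sub>v v))"] v XEv Et by simp
  also have "\<dots> = (X *\<^sub>v (E *\<^sub>v v)) \<bullet> (E *\<^sub>v v)"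
    by (rule transpose_vec_mult_scalar[OF E v XEv])
  also have "\<dots> = (E *\<^sub>v v) \<bullet> (X *\<^sub>v (E *\<^sub>v v))" using XEv Ev by (rule comm_scalar_prod)
  finally show ?thesis .
qed

text \<open>The two off-diagonal contributions are transposes of each other and coincide as scalars,
  whence the factor 2.\<close>

lemma four_block_quadratic_form:
  fixes A B D :: "real mat"
  assumes A: "A \<in> carrier_mat k k" and B: "B \<in> carrier_mat k l" and D: "D \<in> carrier_mat l l"
    and x: "x \<in> carrier_vec k" and z: "z \<in> carrier_vec l"
  shows "(x @\<^sub>v z) \<bullet> (four_block_mat A B (transpose_mat B) D *\<^sub>v (x @\<^sub>v z)) =
    x \<bullet> (A *\<^sub>v x) + 2 * (x \<bullet> (B *\<^sub>v z)) + z \<bullet> (D *\<^sub>v z)"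
proof -
  have Bt: "transpose_mat B \<in> carrier_mat l k" using B by auto
  have c: "A *\<^sub>v x \<in> carrier_vec k" "B *\<^sub>v z \<in> carrier_vec k"
    "transpose_mat B *\<^sub>v x \<in> carrier_vec l" "D *\<^sub>v z \<in> carrier_vec l"
    using A B Bt D x z by auto
  have "z \<bullet> (transpose_mat B *\<^sub>v x) = x \<bullet> (B *\<^sub>v z)"
    using transpose_vec_mult_scalar[OF B z x] comm_scalar_prod[OF z c(3)] by simp
  then show ?thesis
    unfolding four_block_mat_mult_vec[OF A B Bt D x z]
    using scalar_prod_append[OF x z, of "A *\<^sub>v x + B *\<^sub>v z" "transpose_mat B *\<^sub>v x + D *\<^sub>v z"] c x z
    by (simp add: scalar_prod_add_distrib[of _ k] scalar_prod_add_distrib[of _ l])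
qed

text \<open>Symmetry of a local matrix is known only for the whole, whereas the auxiliary matrix
  uses its blocks separately. The block symmetries are read off entrywise, with offset
  \<open>k\<close> into the second block.\<close>

lemma four_block_symmetric:
  assumes M: "transpose_mat (four_block_mat A B C D) = four_block_mat A B C D"
    and A: "A \<in> carrier_mat k k" and B: "B \<in> carrier_mat k l"
    and C: "C \<in> carrier_mat l k" and D: "D \<in> carrier_mat l l"
  shows "transpose_mat A = A" "transpose_mat B = C" "transpose_mat D = D"
proof -
  have ent: "four_block_mat A B C D $$ (j,i) = four_block_mat A B C D $$ (i,j)"
    if "i < k + l" "j < k + l" for i j
    using arg_cong[OF M, of "\<lambda>X. X $$ (i,j)"] that A D by simp
  show "transpose_mat A = A"
  proof (rule eq_matI)
    fix i j assume "i < dim_row A" "j < dim_col A"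
    then show "transpose_mat A $$ (i,j) = A $$ (i,j)" using ent[of i j] A D by simp
  qed (use A in auto)
  show "transpose_mat B = C"
  proof (rule eq_matI)
    fix i j assume "i < dim_row C" "j < dim_col C"
    then show "transpose_mat B $$ (i,j) = C $$ (i,j)" using ent[of "k + i" j] A B C D by simp
  qed (use B C in auto)
  show "transpose_mat D = D"
  proof (rule eq_matI)
    fix i j assume "i < dim_row D" "j < dim_col D"
    then show "transpose_mat D $$ (i,j) = D $$ (i,j)" using ent[of "k + i" "k + j"] A D by simp
  qed (use D in auto)
qed

lemma transpose_mat_sum:
  assumes "\<And>i. i \<in> I \<Longrightarrow> M i \<in> carrier_mat n n" "\<And>i. i \<in> I \<Longrightarrow> transpose_mat (M i) = M i"
  shows "transpose_mat (mat_sum n n M I) = mat_sum n n M I"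
proof (rule eq_matI)
  fix r s assume rs: "r < dim_row (mat_sum n n M I)" "s < dim_col (mat_sum n n M I)"
  have "M i $$ (s,r) = M i $$ (r,s)" if "i \<in> I" for i
    using arg_cong[OF assms(2)[OF that], of "\<lambda>X. X $$ (r,s)"] assms(1)[OF that] rs
    by (simp add: mat_sum_def)
  then show "transpose_mat (mat_sum n n M I) $$ (r,s) = mat_sum n n M I $$ (r,s)"
    using rs by (simp add: mat_sum_def)
qed (auto simp: mat_sum_def)

section \<open>The domain decomposition preconditioner\<close>

theorem lemma4p1:
  fixes n N N1 N2 Nt1 :: nat
    and fine coarse :: "nat \<Rightarrow> nat list"
    and A11 A12 A21 A22 Aloc Rf Rc Rloc :: "nat \<Rightarrow> real mat"
    and A At11 At12 At21 At22 At R1 R D11 D22 D Pi_D pi_D Cinv C :: "real mat"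
    and c_Pi :: real
  assumes N: "N = N1 + N2" and N_pos: "0 < N"
    and fine_distinct: "\<And>i. i < n \<Longrightarrow> distinct (fine i)"
    and coarse_distinct: "\<And>i. i < n \<Longrightarrow> distinct (coarse i)"
    and fine_cover: "(\<Union>i<n. set (fine i)) = {..<N1}"
    and coarse_cover: "(\<Union>i<n. set (coarse i)) = {..<N2}"
    and Rf: "\<And>i. i < n \<Longrightarrow> Rf i = restriction_mat N1 (fine i)"
    and Rc: "\<And>i. i < n \<Longrightarrow> Rc i = restriction_mat N2 (coarse i)"
    and Rloc: "\<And>i. i < n \<Longrightarrow> Rloc i = block_diag2 (Rf i) (Rc i)"
    and A11_dim: "\<And>i. i < n \<Longrightarrow> A11 i \<in> carrier_mat (length (fine i)) (length (fine i))"
    and A12_dim: "\<And>i. i < n \<Longrightarrow> A12 i \<in> carrier_mat (length (fine i)) (length (coarse i))"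
    and A21_dim: "\<And>i. i < n \<Longrightarrow> A21 i \<in> carrier_mat (length (coarse i)) (length (fine i))"
    and A22_dim: "\<And>i. i < n \<Longrightarrow> A22 i \<in> carrier_mat (length (coarse i)) (length (coarse i))"
    and Aloc: "\<And>i. i < n \<Longrightarrow> Aloc i = four_block_mat (A11 i) (A12 i) (A21 i) (A22 i)"
    and Aloc_spsd: "\<And>i. i < n \<Longrightarrow> spsd_mat (length (fine i) + length (coarse i)) (Aloc i)"
    and A: "A = mat_sum N N (\<lambda>i. transpose_mat (Rloc i) * Aloc i * Rloc i) {..<n}"
    and A_spd: "spd_mat N A"
    and At11: "At11 = diag_block_mat (map A11 [0..<n])"
    and At12: "At12 = stack_rows N2 (map (\<lambda>i. A12 i * Rc i) [0..<n])"
    and At21: "At21 = transpose_mat At12"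
    and At22: "At22 = mat_sum N2 N2 (\<lambda>i. transpose_mat (Rc i) * A22 i * Rc i) {..<n}"
    and At: "At = four_block_mat At11 At12 At21 At22"
    and At_invertible: "invertible_mat At"
    and R1: "transpose_mat R1 = stack_rows N1 (map Rf [0..<n])"
    and R: "R = block_diag2 R1 (1\<^sub>m N2)"
    and Nt1: "Nt1 = (\<Sum>i<n. length (fine i))"
    and D11_dim: "D11 \<in> carrier_mat Nt1 Nt1"
    and D22_dim: "D22 \<in> carrier_mat N2 N2"
    and D: "D = block_diag2 D11 D22"
    and RDR_invertible: "invertible_mat (R * D * transpose_mat R)"
    and Pi_D: "Pi_D = mat_inv (R * D * transpose_mat R) * (R * D)"
    and pi_D: "pi_D = transpose_mat R * Pi_D"
    and Cinv: "Cinv = Pi_D * mat_inv At * transpose_mat Pi_D"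
    and C: "C = mat_inv Cinv"
    and c_Pi: "c_Pi = (induced_norm At pi_D)\<^sup>2"
  shows "(\<forall>v \<in> carrier_vec N.
            v \<bullet> (C *\<^sub>v v) \<le> v \<bullet> (A *\<^sub>v v) \<and>
            v \<bullet> (A *\<^sub>v v) \<le> c_Pi * (v \<bullet> (C *\<^sub>v v))) \<and>
         spectral_cond (Cinv * A) \<le> c_Pi"
proof -

  \<comment> \<open>Shapes and symmetry of the blocks\<close>
  let ?is = "[0..<n]"
  let ?lf = "\<lambda>i. length (fine i)" and ?lc = "\<lambda>i. length (coarse i)"
  have list_sum: "(\<Sum>i\<leftarrow>?is. f i) = (\<Sum>i<n. f i)" for f :: "nat \<Rightarrow> 'a :: comm_monoid_add"
    by (simp add: interv_sum_list_conv_sum_set_nat atLeast0LessThan)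
  have Rf_dim: "Rf i \<in> carrier_mat (?lf i) N1" and Rc_dim: "Rc i \<in> carrier_mat (?lc i) N2"
    if "i < n" for i using Rf Rc that by (auto simp: restriction_mat_def)
  have sym: "transpose_mat (A11 i) = A11 i" "transpose_mat (A12 i) = A21 i" "transpose_mat (A22 i) = A22 i"
    if i: "i < n" for i
    using four_block_symmetric[OF _ A11_dim[OF i] A12_dim[OF i] A21_dim[OF i] A22_dim[OF i]]
      Aloc[OF i] Aloc_spsd[OF i] unfolding spsd_mat_def by auto
  have Aloc_dim: "Aloc i \<in> carrier_mat (?lf i + ?lc i) (?lf i + ?lc i)" if "i < n" for i
    using Aloc_spsd[OF that] unfolding spsd_mat_def by auto

  have At11_dim: "At11 \<in> carrier_mat Nt1 Nt1"
    using diag_block_mat_carrier[of ?is A11 ?lf] A11_dim unfolding At11 Nt1 list_sum by simp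
  have A12Rc_dim: "A12 i * Rc i \<in> carrier_mat (?lf i) N2" if "i < n" for i
    using A12_dim[OF that] Rc_dim[OF that] by auto
  have At12_dim: "At12 \<in> carrier_mat Nt1 N2"
    using stack_rows_carrier[of ?is "\<lambda>i. A12 i * Rc i" ?lf N2] A12Rc_dim
    unfolding At12 Nt1 list_sum by simp
  have At22_dim: "At22 \<in> carrier_mat N2 N2" unfolding At22 mat_sum_def by simp
  have At_dim: "At \<in> carrier_mat (Nt1 + N2) (Nt1 + N2)"
    unfolding At using At11_dim At22_dim by auto
  have R1t_dim: "transpose_mat R1 \<in> carrier_mat Nt1 N1"
    using stack_rows_carrier[of ?is Rf ?lf N1] Rf_dim unfolding R1 Nt1 list_sum by simp
  then have R1_dim: "R1 \<in> carrier_mat N1 Nt1" by auto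
  have R_dim: "R \<in> carrier_mat N (Nt1 + N2)"
    unfolding R N by (rule block_diag2_carrier[OF R1_dim one_carrier_mat])

  have A22Rc_dim: "transpose_mat (Rc i) * A22 i * Rc i \<in> carrier_mat N2 N2" if "i < n" for i
    using A22_dim[OF that] Rc_dim[OF that] by auto
  have At22_sym: "transpose_mat At22 = At22"
    unfolding At22
  proof (rule transpose_mat_sum)
    fix i assume "i \<in> {..<n}"
    then have i: "i < n" by simp
    note A22_dim[OF i] Rc_dim[OF i]
    then show "transpose_mat (transpose_mat (Rc i) * A22 i * Rc i) = transpose_mat (Rc i) * A22 i * Rc i"
      using sym(3)[OF i] transpose_mult[of "transpose_mat (Rc i) * A22 i" N2 "?lc i" "Rc i" N2]
        transpose_mult[of "transpose_mat (Rc i)" N2 "?lc i" "A22 i" "?lc i"]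
        assoc_mult_mat[of "transpose_mat (Rc i)" N2 "?lc i" "A22 i" "?lc i" "Rc i" N2]
      by simp
  qed (use A22Rc_dim in auto)
  have At11_sym: "transpose_mat At11 = At11"
    unfolding At11 using A11_dim sym(1) by (intro transpose_diag_block_mat[of _ _ ?lf]) auto
  have At_sym: "transpose_mat At = At"
    unfolding At At21
    using transpose_four_block_mat[OF At11_dim At12_dim transpose_carrier_mat[THEN iffD2, OF At12_dim] At22_dim]
      At11_sym At22_sym by simp

  \<comment> \<open>Splitting the auxiliary energy into local energies\<close>
  have At_energy: "(stack_vecs (map x ?is) @\<^sub>v z) \<bullet> (At *\<^sub>v (stack_vecs (map x ?is) @\<^sub>v z)) =
      (\<Sum>i<n. (x i @\<^sub>v Rc i *\<^sub>v z) \<bullet> (Aloc i *\<^sub>v (x i @\<^sub>v Rc i *\<^sub>v z)))"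
    if x: "\<And>i. i < n \<Longrightarrow> x i \<in> carrier_vec (?lf i)" and z: "z \<in> carrier_vec N2" for x z
  proof -
    let ?x = "stack_vecs (map x ?is)"
    have xc: "?x \<in> carrier_vec Nt1"
      using stack_vecs_carrier[of ?is x ?lf] x unfolding Nt1 list_sum by simp
    have e11: "?x \<bullet> (At11 *\<^sub>v ?x) = (\<Sum>i<n. x i \<bullet> (A11 i *\<^sub>v x i))"
    proof -
      have "At11 *\<^sub>v ?x = stack_vecs (map (\<lambda>i. A11 i *\<^sub>v x i) ?is)"
        unfolding At11 using A11_dim x by (intro diag_block_mat_mult_stack_vecs[of _ _ ?lf]) auto
      then show ?thesis
        using scalar_prod_stack_vecs[of ?is x ?lf "\<lambda>i. A11 i *\<^sub>v x i"] x
          mult_mat_vec_carrier[OF A11_dim x] by (simp add: list_sum)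
    qed
    have e12: "?x \<bullet> (At12 *\<^sub>v z) = (\<Sum>i<n. x i \<bullet> (A12 i *\<^sub>v (Rc i *\<^sub>v z)))"
    proof -
      have "At12 *\<^sub>v z = stack_vecs (map (\<lambda>i. (A12 i * Rc i) *\<^sub>v z) ?is)"
        unfolding At12 using A12Rc_dim z by (intro stack_rows_mult_vec[of _ _ ?lf]) auto
      then have "?x \<bullet> (At12 *\<^sub>v z) = (\<Sum>i<n. x i \<bullet> ((A12 i * Rc i) *\<^sub>v z))"
        using scalar_prod_stack_vecs[of ?is x ?lf "\<lambda>i. (A12 i * Rc i) *\<^sub>v z"] x
          mult_mat_vec_carrier[OF A12Rc_dim z] by (simp add: list_sum)
      also have "\<dots> = (\<Sum>i<n. x i \<bullet> (A12 i *\<^sub>v (Rc i *\<^sub>v z)))"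
        using assoc_mult_mat_vec[OF A12_dim Rc_dim z] by (intro sum.cong) auto
      finally show ?thesis .
    qed
    have e22: "z \<bullet> (At22 *\<^sub>v z) = (\<Sum>i<n. (Rc i *\<^sub>v z) \<bullet> (A22 i *\<^sub>v (Rc i *\<^sub>v z)))"
    proof -
      have "z \<bullet> (At22 *\<^sub>v z) = (\<Sum>i<n. z \<bullet> ((transpose_mat (Rc i) * A22 i * Rc i) *\<^sub>v z))"
        unfolding At22 using A22Rc_dim z by (intro mat_sum_quadratic_form) auto
      also have "\<dots> = (\<Sum>i<n. (Rc i *\<^sub>v z) \<bullet> (A22 i *\<^sub>v (Rc i *\<^sub>v z)))"
        using congruence_quadratic_form[OF Rc_dim A22_dim z] by (intro sum.cong) auto
      finally show ?thesis .
    qed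
    \<comment> \<open>Symmetry of \<open>Aloc i\<close> makes \<open>A21 i\<close> the transpose of
      \<open>A12 i\<close>, so the local energy has the same three terms as the auxiliary
      one.\<close>
    have loc: "(x i @\<^sub>v Rc i *\<^sub>v z) \<bullet> (Aloc i *\<^sub>v (x i @\<^sub>v Rc i *\<^sub>v z)) =
        x i \<bullet> (A11 i *\<^sub>v x i) + 2 * (x i \<bullet> (A12 i *\<^sub>v (Rc i *\<^sub>v z)))
        + (Rc i *\<^sub>v z) \<bullet> (A22 i *\<^sub>v (Rc i *\<^sub>v z))" if i: "i < n" for i
      using four_block_quadratic_form[OF A11_dim[OF i] A12_dim[OF i] A22_dim[OF i] x[OF i]
          mult_mat_vec_carrier[OF Rc_dim[OF i] z]]
      by (simp add: Aloc[OF i] sym(2)[OF i])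
    have "(?x @\<^sub>v z) \<bullet> (At *\<^sub>v (?x @\<^sub>v z)) =
        ?x \<bullet> (At11 *\<^sub>v ?x) + 2 * (?x \<bullet> (At12 *\<^sub>v z)) + z \<bullet> (At22 *\<^sub>v z)"
      unfolding At At21 by (rule four_block_quadratic_form[OF At11_dim At12_dim At22_dim xc z])
    also have "\<dots> = (\<Sum>i<n. (x i @\<^sub>v Rc i *\<^sub>v z) \<bullet> (Aloc i *\<^sub>v (x i @\<^sub>v Rc i *\<^sub>v z)))"
      unfolding e11 e12 e22 by (simp add: loc sum.distrib sum_distrib_left)
    finally show ?thesis .
  qed

  \<comment> \<open>Definiteness of the auxiliary matrix\<close>
  have "0 \<le> w \<bullet> (At *\<^sub>v w)" if w: "w \<in> carrier_vec (Nt1 + N2)" for w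
  proof -
    define z where "z = vec_last w N2"
    have z: "z \<in> carrier_vec N2" by (simp add: z_def)
    \<comment> \<open>Only the fine part is cut into independent local pieces; the coarse part
      \<open>z\<close> is shared by all subdomains through \<open>Rc i\<close>.\<close>
    obtain x where x: "\<forall>i\<in>set ?is. x i \<in> carrier_vec (?lf i)" "vec_first w Nt1 = stack_vecs (map x ?is)"
      using stack_vecs_exists[of ?is "vec_first w Nt1" ?lf] unfolding list_sum Nt1 by auto
    have "w = stack_vecs (map x ?is) @\<^sub>v z" using w x(2) by (metis vec_first_last_append z_def)
    then have "w \<bullet> (At *\<^sub>v w) = (\<Sum>i<n. (x i @\<^sub>v Rc i *\<^sub>v z) \<bullet> (Aloc i *\<^sub>v (x i @\<^sub>v Rc i *\<^sub>v z)))"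
      using At_energy[of x z] x(1) z by simp
    also have "\<dots> \<ge> 0"
    proof (rule sum_nonneg)
      fix i assume "i \<in> {..<n}"
      then have i: "i < n" by simp
      then have "x i @\<^sub>v Rc i *\<^sub>v z \<in> carrier_vec (?lf i + ?lc i)"
        using x(1) mult_mat_vec_carrier[OF Rc_dim[OF i] z] by auto
      then show "0 \<le> (x i @\<^sub>v Rc i *\<^sub>v z) \<bullet> (Aloc i *\<^sub>v (x i @\<^sub>v Rc i *\<^sub>v z))"
        using Aloc_spsd[OF i] unfolding spsd_mat_def by auto
    qed
    finally show ?thesis .
  qed
  then have "spsd_mat (Nt1 + N2) At" using At_dim At_sym unfolding spsd_mat_def by auto
  then have At_spd: "spd_mat (Nt1 + N2) At"
    using det_nonzero_of_invertible[OF At_dim At_invertible] by (rule spsd_det_nonzero_imp_spd)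

  \<comment> \<open>The energy of the assembled matrix\<close>
  have energy: "v \<bullet> (A *\<^sub>v v) = (transpose_mat R *\<^sub>v v) \<bullet> (At *\<^sub>v (transpose_mat R *\<^sub>v v))"
    if v: "v \<in> carrier_vec N" for v
  proof -
    define v1 v2 where "v1 = vec_first v N1" and "v2 = vec_last v N2"
    have v1: "v1 \<in> carrier_vec N1" and v2: "v2 \<in> carrier_vec N2" by (auto simp: v1_def v2_def)
    have vv: "v = v1 @\<^sub>v v2" using v unfolding N v1_def v2_def by simp
    \<comment> \<open>\<open>R^T\<close> copies the fine values into each subdomain and keeps the
      coarse values, so the local pieces are exactly the restrictions \<open>Rloc i\<close> of
      \<open>v\<close>.\<close>
    have "transpose_mat R *\<^sub>v v = (transpose_mat R1 *\<^sub>v v1) @\<^sub>v v2"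
      unfolding R transpose_block_diag2[OF R1_dim one_carrier_mat] vv
      using block_diag2_mult_vec[OF R1t_dim one_carrier_mat v1 v2] v2 by simp
    also have "transpose_mat R1 *\<^sub>v v1 = stack_vecs (map (\<lambda>i. Rf i *\<^sub>v v1) ?is)"
      unfolding R1 using Rf_dim v1 by (intro stack_rows_mult_vec[of _ _ ?lf]) auto
    finally have Rv: "transpose_mat R *\<^sub>v v = stack_vecs (map (\<lambda>i. Rf i *\<^sub>v v1) ?is) @\<^sub>v v2" .
    have Rloc_dim: "Rloc i \<in> carrier_mat (?lf i + ?lc i) N" if "i < n" for i
      unfolding Rloc[OF that] N by (rule block_diag2_carrier[OF Rf_dim[OF that] Rc_dim[OF that]])
    have Rloc_v: "Rloc i *\<^sub>v v = Rf i *\<^sub>v v1 @\<^sub>v Rc i *\<^sub>v v2" if "i < n" for i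
      unfolding Rloc[OF that] vv by (rule block_diag2_mult_vec[OF Rf_dim[OF that] Rc_dim[OF that] v1 v2])
    have "v \<bullet> (A *\<^sub>v v) = (\<Sum>i<n. v \<bullet> ((transpose_mat (Rloc i) * Aloc i * Rloc i) *\<^sub>v v))"
      unfolding A
    proof (rule mat_sum_quadratic_form[OF _ v])
      fix i assume "i \<in> {..<n}"
      then show "transpose_mat (Rloc i) * Aloc i * Rloc i \<in> carrier_mat N N"
        using Rloc_dim[of i] Aloc_dim[of i] by auto
    qed
    also have "\<dots> = (\<Sum>i<n. (Rloc i *\<^sub>v v) \<bullet> (Aloc i *\<^sub>v (Rloc i *\<^sub>v v)))"
      using congruence_quadratic_form[OF Rloc_dim Aloc_dim v] by (intro sum.cong) auto
    also have "\<dots> = (transpose_mat R *\<^sub>v v) \<bullet> (At *\<^sub>v (transpose_mat R *\<^sub>v v))"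
      unfolding Rv using At_energy[of "\<lambda>i. Rf i *\<^sub>v v1" v2] mult_mat_vec_carrier[OF Rf_dim v1] v2
      by (simp add: Rloc_v)
    finally show ?thesis .
  qed

  \<comment> \<open>The weighted projection and the conclusion\<close>
  have D_dim: "D \<in> carrier_mat (Nt1 + N2) (Nt1 + N2)"
    unfolding D by (rule block_diag2_carrier[OF D11_dim D22_dim])
  have RD_dim: "R * D \<in> carrier_mat N (Nt1 + N2)" using R_dim D_dim by auto
  have Rt_dim: "transpose_mat R \<in> carrier_mat (Nt1 + N2) N" using R_dim by auto
  have S_dim: "R * D * transpose_mat R \<in> carrier_mat N N" using RD_dim Rt_dim by auto
  note dS = det_nonzero_of_invertible[OF S_dim RDR_invertible]
  note Si = mat_inv_carrier[OF S_dim dS]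
  have Pi_dim: "Pi_D \<in> carrier_mat N (Nt1 + N2)" unfolding Pi_D using Si RD_dim by auto
  \<comment> \<open>Reassociating puts \<open>R D R^T\<close> next to its own inverse. Through this
    identity \<open>Pi_D\<close> qualifies as the operator \<open>P\<close> of the abstract
    estimate, and \<open>pi_D\<close> is then the matrix whose norm appears there.\<close>
  have PiR: "Pi_D * transpose_mat R = 1\<^sub>m N"
    unfolding Pi_D assoc_mult_mat[OF Si RD_dim Rt_dim] by (rule mat_inv_mult[OF S_dim dS])
  show ?thesis
    using auxiliary_space_bounds[OF At_spd A_spd N_pos R_dim Pi_dim PiR energy]
    unfolding C Cinv c_Pi pi_D by blast
qed

end
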